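(* Let $\mathbb F$ be a field of characteristic different from $2$ and let $\tau=(\tau_{abc})_{a,b,c\in\{0,1\}}$ be an arbitrary $2\times2\times2$ array of elements of $\mathbb F$. Let $G_1,G_2,G_3$ be the symmetric $2\times2$ matrices and, for $x,y,z\in\mathbb F^2$, let $M_x,N_y,P_z$ be the $2\times 2$ matrices attached to $\tau$ as in the context. Then $$M_x\,\operatorname{adj}(G_3)\,M_x^T=-\tfrac12\,(x^TG_1x)\,G_2\quad\text{for all }x\in\mathbb F^2,$$ $$N_y\,\operatorname{adj}(G_3)\,N_y^T=-\tfrac12\,(y^TG_2y)\,G_1\quad\text{for all }y\in\mathbb F^2,$$ $$P_z\,\operatorname{adj}(G_2)\,P_z^T=-\tfrac12\,(z^TG_3z)\,G_1\quad\text{for all }z\in\mathbb F^2 .$$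
   Context: The array $\tau_{abc}$ is the coordinate form, in symplectic bases, of a tensor $\tau\in V_1\otimes V_2\otimes V_3$ ("triality symbol") where $V_1,V_2,V_3$ are two-dimensional $\mathbb F$-vector spaces each with a chosen non-degenerate alternating form with matrix $\varepsilon$: $\varepsilon_{00}=\varepsilon_{11}=0$, $\varepsilon_{01}=1$, $\varepsilon_{10}=-1$. Define $$(G_1)_{aa'}=\sum_{b,b',c,c'}\varepsilon_{bb'}\varepsilon_{cc'}\tau_{abc}\tau_{a'b'c'},\quad (G_2)_{bb'}=\sum_{a,a',c,c'}\varepsilon_{aa'}\varepsilon_{cc'}\tau_{abc}\tau_{a'b'c'},\quad (G_3)_{cc'}=\sum_{a,a',b,b'}\varepsilon_{aa'}\varepsilon_{bb'}\tau_{abc}\tau_{a'b'c'} .$$ For $x,y,z\in\mathbb F^2$ (coordinate vectors of elements of $V_1,V_2,V_3$ respectively), contraction gives the matrices $$(M_x)_{bc}=\sum_a x_a\tau_{abc},\qquad (N_y)_{ac}=\sum_b y_b\tau_{abc},\qquad (P_z)_{ab}=\sum_c z_c\tau_{abc}.$$ $\operatorname{adj}$ denotes the adjugate matrix. *)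

theory Defs
  imports "Jordan_Normal_Form.Determinant"
begin

text \<open>
  Indices are the natural numbers 0 and 1; an array is a function
  \<open>nat \<Rightarrow> nat \<Rightarrow> nat \<Rightarrow> 'a\<close> of which only the eight values at indices below 2 are ever used.
\<close>

definition eps :: "'a :: comm_ring_1 mat" where
  "eps = mat_of_rows_list 2 [[0, 1], [- 1, 0]]"

definition G1 :: "(nat \<Rightarrow> nat \<Rightarrow> nat \<Rightarrow> 'a :: comm_ring_1) \<Rightarrow> 'a mat" where
  "G1 \<tau> = mat 2 2 (\<lambda>(a, a'). \<Sum>b<2. \<Sum>b'<2. \<Sum>c<2. \<Sum>c'<2.
     eps $$ (b, b') * eps $$ (c, c') * \<tau> a b c * \<tau> a' b' c')"

definition G2 :: "(nat \<Rightarrow> nat \<Rightarrow> nat \<Rightarrow> 'a :: comm_ring_1) \<Rightarrow> 'a mat" where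
  "G2 \<tau> = mat 2 2 (\<lambda>(b, b'). \<Sum>a<2. \<Sum>a'<2. \<Sum>c<2. \<Sum>c'<2.
     eps $$ (a, a') * eps $$ (c, c') * \<tau> a b c * \<tau> a' b' c')"

definition G3 :: "(nat \<Rightarrow> nat \<Rightarrow> nat \<Rightarrow> 'a :: comm_ring_1) \<Rightarrow> 'a mat" where
  "G3 \<tau> = mat 2 2 (\<lambda>(c, c'). \<Sum>a<2. \<Sum>a'<2. \<Sum>b<2. \<Sum>b'<2.
     eps $$ (a, a') * eps $$ (b, b') * \<tau> a b c * \<tau> a' b' c')"

definition Mmat :: "(nat \<Rightarrow> nat \<Rightarrow> nat \<Rightarrow> 'a :: comm_ring_1) \<Rightarrow> 'a vec \<Rightarrow> 'a mat" where
  "Mmat \<tau> x = mat 2 2 (\<lambda>(b, c). \<Sum>a<2. x $ a * \<tau> a b c)"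

definition Nmat :: "(nat \<Rightarrow> nat \<Rightarrow> nat \<Rightarrow> 'a :: comm_ring_1) \<Rightarrow> 'a vec \<Rightarrow> 'a mat" where
  "Nmat \<tau> y = mat 2 2 (\<lambda>(a, c). \<Sum>b<2. y $ b * \<tau> a b c)"

definition Pmat :: "(nat \<Rightarrow> nat \<Rightarrow> nat \<Rightarrow> 'a :: comm_ring_1) \<Rightarrow> 'a vec \<Rightarrow> 'a mat" where
  "Pmat \<tau> z = mat 2 2 (\<lambda>(a, b). \<Sum>c<2. z $ c * \<tau> a b c)"

lemma eps_entries [simp]:
  "eps $$ (0, 0) = 0" "eps $$ (0, Suc 0) = 1" "eps $$ (Suc 0, 0) = - 1" "eps $$ (Suc 0, Suc 0) = 0"
  by (simp_all add: eps_def mat_of_rows_list_def)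

lemma G_symmetric:
  "transpose_mat (G1 \<tau>) = G1 \<tau>" "transpose_mat (G2 \<tau>) = G2 \<tau>" "transpose_mat (G3 \<tau>) = G3 \<tau>"
  by (rule eq_matI; auto simp: G1_def G2_def G3_def numeral_2_eq_2 less_Suc_eq algebra_simps)+

end

theory Submission
  imports Defs
begin

text \<open>
  Since \<open>x\<^sup>T G\<^sub>1 x = 2 det M\<^sub>x\<close>, the first identity is \<open>M\<^sub>x adj(G\<^sub>3) M\<^sub>x\<^sup>T = - det(M\<^sub>x) G\<^sub>2\<close>,
  a polynomial identity over the integers that is checked entrywise. Permuting the three
  tensor factors turns it into the other two identities.
\<close>

text \<open>The adjugate is the transposed cofactor matrix. Off the diagonal the transposition is
  cancelled, since \<open>i \<noteq> j\<close> gives \<open>1 - j = i\<close> and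
  \<open>1 - i = j\<close>, so only the sign remains.\<close>

lemma adj_mat_2:
  fixes A :: "'a :: comm_ring_1 mat"
  assumes A: "A \<in> carrier_mat 2 2"
  shows "adj_mat A = mat 2 2 (\<lambda>(i, j).
    if i = j then A $$ (1 - i, 1 - i) else - A $$ (i, j))"
proof (rule eq_matI)
  fix i j
  assume "i < dim_row (mat 2 2 (\<lambda>(i, j). if i = j then A $$ (1 - i, 1 - i) else - A $$ (i, j)))"
    and "j < dim_col (mat 2 2 (\<lambda>(i, j). if i = j then A $$ (1 - i, 1 - i) else - A $$ (i, j)))"
  then have "i = 0 \<or> i = 1" "j = 0 \<or> j = 1" by auto
  then show "adj_mat A $$ (i, j) =
      mat 2 2 (\<lambda>(i, j). if i = j then A $$ (1 - i, 1 - i) else - A $$ (i, j)) $$ (i, j)"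
    using A by (auto simp: adj_mat_def cofactor_def det_single mat_delete_def)
qed (use A in \<open>auto simp: adj_mat_def\<close>)

lemma det_mat_2:
  fixes A :: "'a :: comm_ring_1 mat"
  assumes A: "A \<in> carrier_mat 2 2"
  shows "det A = A $$ (0, 0) * A $$ (1, 1) - A $$ (0, 1) * A $$ (1, 0)"
  using A laplace_expansion_row[OF A, of 0]
  by (simp add: numeral_2_eq_2 cofactor_def det_single mat_delete_def)

text \<open>Contracting both copies of \<open>\<tau>\<close> with \<open>x\<close> leaves the sum of
  \<open>eps_bb' eps_cc' M_bc M_b'c'\<close>, whose four nonzero terms are the two terms of
  \<open>det M\<close>, each occurring twice.\<close>

lemma G1_quadratic_form:
  assumes "x \<in> carrier_vec 2"
  shows "x \<bullet> (G1 \<tau> *\<^sub>v x) = 2 * det (Mmat \<tau> x)"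
proof -
  have "det (Mmat \<tau> x) = Mmat \<tau> x $$ (0, 0) * Mmat \<tau> x $$ (1, 1) - Mmat \<tau> x $$ (0, 1) * Mmat \<tau> x $$ (1, 0)"
    by (rule det_mat_2) (simp add: Mmat_def)
  then show ?thesis
    unfolding \<open>det (Mmat \<tau> x) = _\<close>
    using assms by (simp add: G1_def Mmat_def scalar_prod_def numeral_2_eq_2 algebra_simps)
qed

text \<open>Writing the factor as a determinant avoids dividing by 2, so any commutative ring is
  allowed. The determinant arises from \<open>adj G3 = eps G3 eps^T\<close> and
  \<open>M eps M^T = det M eps\<close>.\<close>

lemma Mmat_adj_G3:
  "Mmat \<tau> x * adj_mat (G3 \<tau>) * transpose_mat (Mmat \<tau> x) = (- det (Mmat \<tau> x)) \<cdot>\<^sub>m G2 \<tau>"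
proof -
  have det: "det (Mmat \<tau> x) = Mmat \<tau> x $$ (0, 0) * Mmat \<tau> x $$ (1, 1) - Mmat \<tau> x $$ (0, 1) * Mmat \<tau> x $$ (1, 0)"
    by (rule det_mat_2) (simp add: Mmat_def)
  have adj: "adj_mat (G3 \<tau>) = mat 2 2 (\<lambda>(i, j).
      if i = j then G3 \<tau> $$ (1 - i, 1 - i) else - G3 \<tau> $$ (i, j))"
    by (rule adj_mat_2) (simp add: G3_def)
  show ?thesis
    unfolding det adj
    by (rule eq_matI; auto simp: G2_def G3_def Mmat_def scalar_prod_def numeral_2_eq_2 less_Suc_eq; simp add: algebra_simps)
qed

lemma triality_identity:
  fixes \<tau> :: "nat \<Rightarrow> nat \<Rightarrow> nat \<Rightarrow> 'a :: field"
  assumes "CHAR('a) \<noteq> 2" and "x \<in> carrier_vec 2"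
  shows "Mmat \<tau> x * adj_mat (G3 \<tau>) * transpose_mat (Mmat \<tau> x)
    = (- (1 / 2) * (x \<bullet> (G1 \<tau> *\<^sub>v x))) \<cdot>\<^sub>m G2 \<tau>"
proof -
  \<comment> \<open>If 2 vanished, the characteristic would divide the prime 2; it is not 1 in a
    field, so it would be 2.\<close>
  have "(2 :: 'a) \<noteq> 0"
    using assms(1) of_nat_eq_0_iff_char_dvd[of 2, where 'a = 'a]
      prime_nat_iff[of 2] two_is_prime_nat by auto
  then show ?thesis
    using assms(2) by (simp add: Mmat_adj_G3 G1_quadratic_form)
qed

theorem theorem4:
  fixes \<tau> :: "nat \<Rightarrow> nat \<Rightarrow> nat \<Rightarrow> 'a :: field"
  assumes "CHAR('a) \<noteq> 2"
  shows "(\<forall>x \<in> carrier_vec 2.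
            Mmat \<tau> x * adj_mat (G3 \<tau>) * transpose_mat (Mmat \<tau> x)
              = (- (1 / 2) * (x \<bullet> (G1 \<tau> *\<^sub>v x))) \<cdot>\<^sub>m G2 \<tau>) \<and>
         (\<forall>y \<in> carrier_vec 2.
            Nmat \<tau> y * adj_mat (G3 \<tau>) * transpose_mat (Nmat \<tau> y)
              = (- (1 / 2) * (y \<bullet> (G2 \<tau> *\<^sub>v y))) \<cdot>\<^sub>m G1 \<tau>) \<and>
         (\<forall>z \<in> carrier_vec 2.
            Pmat \<tau> z * adj_mat (G2 \<tau>) * transpose_mat (Pmat \<tau> z)
              = (- (1 / 2) * (z \<bullet> (G3 \<tau> *\<^sub>v z))) \<cdot>\<^sub>m G1 \<tau>)"
proof (intro conjI ballI)
  fix x :: "'a vec" assume "x \<in> carrier_vec 2"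
  with assms show "Mmat \<tau> x * adj_mat (G3 \<tau>) * transpose_mat (Mmat \<tau> x)
      = (- (1 / 2) * (x \<bullet> (G1 \<tau> *\<^sub>v x))) \<cdot>\<^sub>m G2 \<tau>"
    by (rule triality_identity)
next
  fix y :: "'a vec" assume y: "y \<in> carrier_vec 2"
  \<comment> \<open>Swapping the first two factors puts the index contracted with \<open>y\<close>
    first; \<open>G1\<close> and \<open>G2\<close> trade places and \<open>G3\<close> is
    fixed.\<close>
  let ?\<sigma> = "\<lambda>b a c. \<tau> a b c"
  have "Mmat ?\<sigma> y = Nmat \<tau> y"
    by (simp add: Mmat_def Nmat_def)
  moreover have "G1 ?\<sigma> = G2 \<tau>" "G2 ?\<sigma> = G1 \<tau>" "G3 ?\<sigma> = G3 \<tau>"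
    by (rule eq_matI; auto simp: G1_def G2_def G3_def numeral_2_eq_2 less_Suc_eq algebra_simps)+
  ultimately show "Nmat \<tau> y * adj_mat (G3 \<tau>) * transpose_mat (Nmat \<tau> y)
      = (- (1 / 2) * (y \<bullet> (G2 \<tau> *\<^sub>v y))) \<cdot>\<^sub>m G1 \<tau>"
    using triality_identity[OF assms y, of ?\<sigma>] by simp
next
  fix z :: "'a vec" assume z: "z \<in> carrier_vec 2"
  \<comment> \<open>A cyclic shift keeps \<open>a\<close> before \<open>b\<close>, so contraction
    gives \<open>Pmat\<close>; exchanging \<open>a\<close> and \<open>c\<close> would give its
    transpose.\<close>
  let ?\<sigma> = "\<lambda>c a b. \<tau> a b c"
  have "Mmat ?\<sigma> z = Pmat \<tau> z"
    by (simp add: Mmat_def Pmat_def)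
  moreover have "G1 ?\<sigma> = G3 \<tau>" "G2 ?\<sigma> = G1 \<tau>" "G3 ?\<sigma> = G2 \<tau>"
    by (rule eq_matI; auto simp: G1_def G2_def G3_def numeral_2_eq_2 less_Suc_eq algebra_simps)+
  ultimately show "Pmat \<tau> z * adj_mat (G2 \<tau>) * transpose_mat (Pmat \<tau> z)
      = (- (1 / 2) * (z \<bullet> (G3 \<tau> *\<^sub>v z))) \<cdot>\<^sub>m G1 \<tau>"
    using triality_identity[OF assms z, of ?\<sigma>] by simp
qed

end
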